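(* Let $n \in \mathbb{N}^*$ and, for a natural number $a$, let $$f_a(\mathbf{x}) = (a-1)\prod_{i=1}^n\left(\frac{x_i+1}{2}\right)+1 \in \mathbb{R}[x_1,\dots,x_n].$$ For every $a > \frac{2^n-1}{2^{n-2}-1}$ we have $f_a \notin S_d$ for all $d \in \mathbb{N}$, where $$S_d = \left\{\sum_{\text{finite}} s\cdot h \ :\ s \in C_{n,2d},\ h \in \{1,\ \pm(x_i^2-1),\ 1+c_i\pm x_i \ :\ i\in[n],\ c_i \in \mathbb{R}_{\ge 0}\}\right\}.$$
   Context: $\mathbb{N}$ contains $0$, $\mathbb{N}^* = \mathbb{N}\setminus\{0\}$, and $[n]=\{1,\dots,n\}$. A circuit polynomial is a polynomial $f(\mathbf{x}) = \sum_{j=0}^r f_{\boldsymbol{\alpha}(j)} \mathbf{x}^{\boldsymbol{\alpha}(j)} + f_{\boldsymbol{\beta}} \mathbf{x}^{\boldsymbol{\beta}}$ in $\mathbb{R}[x_1,\dots,x_n]$ with $r \le n$, exponents $\boldsymbol{\alpha}(j),\boldsymbol{\beta} \in \mathbb{N}^n$, $f_{\boldsymbol{\alpha}(j)} > 0$, $f_{\boldsymbol{\beta}} \in \mathbb{R}$, such that the Newton polytope of $f$ is a simplex with vertices $\boldsymbol{\alpha}(0),\dots,\boldsymbol{\alpha}(r) \in (2\mathbb{N})^n$ and $\boldsymbol{\beta}$ lies in the (relative) interior of this simplex. Monomial squares $c\,\mathbf{x}^{\boldsymbol{\alpha}}$ with $c>0$ and $\boldsymbol{\alpha} \in (2\mathbb{N})^n$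 count as nonnegative circuit polynomials. A circuit polynomial is nonnegative if it is nonnegative on all of $\mathbb{R}^n$. $C_{n,2d}$ is the set of SONC polynomials (sums of nonnegative circuit polynomials) in $n$ variables of degree at most $2d$: all polynomials $\sum_{i=1}^k \mu_i q_i$ of degree at most $2d$ with $k\in\mathbb{N}^*$, $\mu_i \ge 0$ and $q_i$ nonnegative circuit polynomials.
   Formalization: The formal theorem assumes n ≥ 3 instead of n ≥ 1: for n = 2 the bound has denominator zero and is undefined, and for n = 1 the bound is −2 and the claim is false (every f_a, e.g. f_1 = 1, lies in S_0). *)

theory Defs
  imports "HOL-Analysis.Analysis" "HOL-Library.Poly_Mapping"
begin

text \<open>
  Polynomials in \<open>\<real>[x\<^sub>1,\<dots>,x\<^sub>n]\<close> are finitely supported maps from exponent vectors in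
  \<open>\<nat>\<^sup>n\<close> to coefficients, with the (convolution) ring structure of
  \<^theory>\<open>HOL-Library.Poly_Mapping\<close>. The variables are indexed by a finite type \<open>'n\<close>, so
  \<open>n = CARD('n)\<close>, and \<open>Poly_Mapping.keys p\<close> is the support of \<open>p\<close>.
\<close>

type_synonym 'n mpoly = "(nat, 'n) vec \<Rightarrow>\<^sub>0 real"

definition Const :: "real \<Rightarrow> ('n::finite) mpoly" where
  "Const c = Poly_Mapping.single 0 c"

definition Var :: "'n::finite \<Rightarrow> 'n mpoly" where
  "Var i = Poly_Mapping.single (axis i 1) 1"

definition eval_mpoly :: "('n::finite) mpoly \<Rightarrow> real ^ 'n \<Rightarrow> real" where
  "eval_mpoly p x = (\<Sum>\<alpha>\<in>Poly_Mapping.keys p. Poly_Mapping.lookup p \<alpha> * (\<Prod>i\<in>UNIV. (x $ i) ^ (\<alpha> $ i)))"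

definition degree_le :: "('n::finite) mpoly \<Rightarrow> nat \<Rightarrow> bool" where
  "degree_le p m \<longleftrightarrow> (\<forall>\<alpha>\<in>Poly_Mapping.keys p. (\<Sum>i\<in>UNIV. \<alpha> $ i) \<le> m)"

definition real_exponent :: "nat ^ 'n \<Rightarrow> real ^ ('n::finite)" where
  "real_exponent \<alpha> = (\<chi> i. real (\<alpha> $ i))"

definition even_exponent :: "nat ^ ('n::finite) \<Rightarrow> bool" where
  "even_exponent \<alpha> \<longleftrightarrow> (\<forall>i. even (\<alpha> $ i))"

definition Newton_polytope :: "('n::finite) mpoly \<Rightarrow> (real ^ 'n) set" where
  "Newton_polytope p = convex hull (real_exponent ` Poly_Mapping.keys p)"

text \<open>
  The simplex condition forces the \<open>r + 1\<close> vertices \<open>\<alpha> 0, \<dots>, \<alpha> r\<close> to be distinct and affinely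
  independent. For \<open>r = 0\<close> the relative interior of the simplex is the single point \<open>\<alpha> 0\<close>, so
  \<open>\<beta> = \<alpha> 0\<close> and \<open>p\<close> is a single term.
\<close>

definition circuit_polynomial :: "('n::finite) mpoly \<Rightarrow> bool" where
  "circuit_polynomial p \<longleftrightarrow>
     (\<exists>(r::nat) (\<alpha> :: nat \<Rightarrow> nat ^ 'n) (f :: nat \<Rightarrow> real) (\<beta> :: nat ^ 'n) (b :: real).
        r \<le> CARD('n) \<and>
        (\<forall>j\<le>r. f j > 0 \<and> even_exponent (\<alpha> j)) \<and>
        p = (\<Sum>j\<le>r. Poly_Mapping.single (\<alpha> j) (f j)) + Poly_Mapping.single \<beta> b \<and>
        int r simplex Newton_polytope p \<and>
        {v. v extreme_point_of Newton_polytope p} = (\<lambda>j. real_exponent (\<alpha> j)) ` {..r} \<and>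
        real_exponent \<beta> \<in> rel_interior (Newton_polytope p))"

definition monomial_square :: "('n::finite) mpoly \<Rightarrow> bool" where
  "monomial_square p \<longleftrightarrow>
     (\<exists>c \<alpha>. c > 0 \<and> even_exponent \<alpha> \<and> p = Poly_Mapping.single \<alpha> c)"

definition nonneg_circuit_polynomial :: "('n::finite) mpoly \<Rightarrow> bool" where
  "nonneg_circuit_polynomial p \<longleftrightarrow>
     (circuit_polynomial p \<and> (\<forall>x. eval_mpoly p x \<ge> 0)) \<or> monomial_square p"

text \<open>\<open>SONC d\<close> is the set \<open>C\<^bsub>n,2d\<^esub>\<close>: the degree bound is \<open>2 * d\<close>, and it constrains the sum only.\<close>

definition SONC :: "nat \<Rightarrow> ('n::finite) mpoly set" where
  "SONC d = {p. degree_le p (2 * d) \<and>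
     (\<exists>(k::nat) \<mu> q. k \<ge> 1 \<and>
        (\<forall>i\<in>{1..k}. \<mu> i \<ge> 0 \<and> nonneg_circuit_polynomial (q i)) \<and>
        p = (\<Sum>i\<in>{1..k}. Const (\<mu> i) * q i))}"

definition hypercube_multipliers :: "('n::finite) mpoly set" where
  "hypercube_multipliers =
     {1} \<union> {(Var i)\<^sup>2 - 1 | i. True} \<union> {- ((Var i)\<^sup>2 - 1) | i. True} \<union>
     {1 + Const c + Var i | i c. c \<ge> 0} \<union> {1 + Const c - Var i | i c. c \<ge> 0}"

definition S :: "nat \<Rightarrow> ('n::finite) mpoly set" where
  "S d = {p. \<exists>(m::nat) s h.
     (\<forall>j<m. s j \<in> SONC d \<and> h j \<in> hypercube_multipliers) \<and> p = (\<Sum>j<m. s j * h j)}"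

definition f_poly :: "nat \<Rightarrow> ('n::finite) mpoly" where
  "f_poly a = Const (real a - 1) * (\<Prod>i\<in>UNIV. Const (1/2) * (Var i + 1)) + 1"

end

theory Submission imports Defs begin

text \<open>
  Restricted to the hypercube \<open>{-1, 1}\<^sup>n\<close>, a circuit polynomial is \<open>A + B \<chi>\<close> with \<open>\<chi>\<close> the character
  \<open>x\<^sup>\<beta>\<close>, and a multiplier depends on a single coordinate \<open>x\<^sub>i\<close>. Hence a product \<open>q h\<close> is nonnegative
  on the cube and takes its value at \<open>(1, \<dots>, 1)\<close> wherever \<open>\<chi> = x\<^sub>i = 1\<close>. This subgroup has
  at least \<open>2\<^bsup>n-2\<^esup>\<close> elements, so the functional \<open>p \<mapsto> \<Sum>\<^sub>x p x - 2\<^bsup>n-2\<^esup> p (1, \<dots>, 1)\<close> is nonnegative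
  on \<open>S d\<close>. It is negative at \<open>f\<^sub>a\<close>, whose value is \<open>a\<close> at \<open>(1, \<dots>, 1)\<close> and \<open>1\<close> elsewhere.
\<close>

section \<open>Evaluation at a point as a ring homomorphism\<close>

definition eval_monom :: "nat ^ ('n::finite) \<Rightarrow> real ^ 'n \<Rightarrow> real" where
  "eval_monom \<alpha> x = (\<Prod>i\<in>UNIV. (x $ i) ^ (\<alpha> $ i))"

lemma eval_monom_0 [simp]: "eval_monom 0 x = 1"
  by (simp add: eval_monom_def)

lemma eval_monom_add: "eval_monom (\<alpha> + \<beta>) x = eval_monom \<alpha> x * eval_monom \<beta> x"
  by (simp add: eval_monom_def power_add prod.distrib)

lemma eval_monom_axis: "eval_monom (axis i k) x = (x $ i) ^ k"
proof -
  have "eval_monom (axis i k) x = (\<Prod>j\<in>UNIV. if j = i then (x $ j) ^ k else 1)"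
    unfolding eval_monom_def by (rule prod.cong) (auto simp: axis_def)
  then show ?thesis by simp
qed

text \<open>Allows two polynomials to be evaluated over one common finite support, which makes
  additivity a termwise statement.\<close>

lemma eval_mpoly_superset:
  assumes "finite A" "Poly_Mapping.keys p \<subseteq> A"
  shows "eval_mpoly p x = (\<Sum>\<alpha>\<in>A. Poly_Mapping.lookup p \<alpha> * eval_monom \<alpha> x)"
  unfolding eval_mpoly_def eval_monom_def
  by (rule sum.mono_neutral_left) (use assms in \<open>auto simp: in_keys_iff\<close>)

lemma eval_mpoly_single [simp]:
  "eval_mpoly (Poly_Mapping.single \<alpha> c) x = c * eval_monom \<alpha> x"
  by (subst eval_mpoly_superset[of "{\<alpha>}"]) auto

lemma eval_mpoly_0 [simp]: "eval_mpoly 0 x = 0"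
  by (simp add: eval_mpoly_def)

lemma eval_mpoly_1 [simp]: "eval_mpoly 1 x = 1"
  by (simp flip: single_one)

lemma eval_mpoly_add [simp]: "eval_mpoly (p + q) x = eval_mpoly p x + eval_mpoly q x"
proof -
  let ?A = "Poly_Mapping.keys p \<union> Poly_Mapping.keys q"
  have "Poly_Mapping.keys (p + q) \<subseteq> ?A" by (rule Poly_Mapping.keys_add)
  then show ?thesis
    by (simp add: eval_mpoly_superset[of ?A] lookup_add sum.distrib algebra_simps)
qed

lemma eval_mpoly_uminus [simp]: "eval_mpoly (- p) x = - eval_mpoly p x"
  using eval_mpoly_add[of p "- p" x] by simp

lemma eval_mpoly_diff [simp]: "eval_mpoly (p - q) x = eval_mpoly p x - eval_mpoly q x"
  using eval_mpoly_add[of p "- q" x] by simp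

lemma eval_mpoly_sum [simp]: "eval_mpoly (\<Sum>j\<in>A. p j) x = (\<Sum>j\<in>A. eval_mpoly (p j) x)"
  by (induction A rule: infinite_finite_induct) auto

text \<open>Every polynomial is the sum of its terms. This reduces multiplicativity of evaluation to
  a product of two terms.\<close>

lemma mpoly_induct [case_names zero single add]:
  fixes p :: "'n::finite mpoly"
  assumes "P 0" "\<And>\<alpha> c. P (Poly_Mapping.single \<alpha> c)" "\<And>p q. P p \<Longrightarrow> P q \<Longrightarrow> P (p + q)"
  shows "P p"
proof -
  have "P (\<Sum>\<alpha>\<in>A. Poly_Mapping.single \<alpha> (Poly_Mapping.lookup p \<alpha>))" for A
    by (induction A rule: infinite_finite_induct) (auto intro: assms)
  moreover have "(\<Sum>\<alpha>\<in>Poly_Mapping.keys p. Poly_Mapping.single \<alpha> (Poly_Mapping.lookup p \<alpha>)) = p"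
    by (rule poly_mapping_eqI)
      (simp add: lookup_sum lookup_single when_def in_keys_iff)
  ultimately show ?thesis by metis
qed

lemma eval_mpoly_mult [simp]: "eval_mpoly (p * q) x = eval_mpoly p x * eval_mpoly q x"
proof (induction p rule: mpoly_induct)
  case (single \<alpha> c)
  show ?case
    by (induction q rule: mpoly_induct)
      (simp_all add: mult_single eval_monom_add algebra_simps)
qed (simp_all add: algebra_simps)

lemma eval_mpoly_power [simp]: "eval_mpoly (p ^ k) x = eval_mpoly p x ^ k"
  by (induction k) auto

lemma eval_mpoly_prod [simp]: "eval_mpoly (\<Prod>j\<in>A. p j) x = (\<Prod>j\<in>A. eval_mpoly (p j) x)"
  by (induction A rule: infinite_finite_induct) auto

lemma eval_mpoly_Const [simp]: "eval_mpoly (Const c) x = c"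
  by (simp add: Const_def)

lemma eval_mpoly_Var [simp]: "eval_mpoly (Var i) x = x $ i"
  by (simp add: Var_def eval_monom_axis)

section \<open>Character sums over the cube\<close>

definition cube :: "(real ^ 'n::finite) set" where
  "cube = {x. \<forall>i. x $ i = 1 \<or> x $ i = -1}"

lemma cube_eq_image: "(cube :: (real ^ 'n::finite) set) = vec_lambda ` Pi\<^sub>E UNIV (\<lambda>_. {1, -1})"
proof (intro equalityI subsetI)
  fix x :: "real ^ 'n" assume "x \<in> cube"
  then show "x \<in> vec_lambda ` Pi\<^sub>E UNIV (\<lambda>_. {1, -1})"
    by (intro image_eqI[of _ _ "\<lambda>i. x $ i"]) (auto simp: cube_def)
qed (auto simp: cube_def PiE_def)

lemma finite_cube [simp]: "finite cube"
  by (simp add: cube_eq_image finite_PiE)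

text \<open>A sum of products over a product set factors into one sum per coordinate. Each factor is
  2 for an even exponent and 0 for an odd one.\<close>

lemma sum_cube_eval_monom:
  fixes \<beta> :: "nat ^ 'n::finite"
  shows "(\<Sum>x\<in>cube. eval_monom \<beta> x) = (\<Prod>i\<in>UNIV. 1 + (-1) ^ (\<beta> $ i))"
proof -
  have "(\<Sum>x\<in>cube. eval_monom \<beta> x) =
      (\<Sum>g\<in>Pi\<^sub>E UNIV (\<lambda>_. {1, -1}). \<Prod>i\<in>UNIV. g i ^ (\<beta> $ i))"
    unfolding cube_eq_image
    by (subst sum.reindex) (auto simp: inj_on_def vec_lambda_inject eval_monom_def)
  also have "\<dots> = (\<Prod>i\<in>UNIV. \<Sum>t\<in>{1, -1::real}. t ^ (\<beta> $ i))"
    by (rule prod_sum_PiE[symmetric]) auto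
  finally show ?thesis by simp
qed

lemma card_cube: "card (cube :: (real ^ 'n::finite) set) = 2 ^ CARD('n)"
proof -
  have "real (card (cube :: (real ^ 'n) set)) = real (2 ^ CARD('n))"
    \<comment> \<open>The exponent 0 gives the trivial character, whose sum counts the
      points.\<close>
    using sum_cube_eval_monom[of "0 :: nat ^ 'n"] by simp
  then show ?thesis by (simp only: of_nat_eq_iff)
qed

lemma sum_cube_eval_monom_nonneg: "(\<Sum>x\<in>cube. eval_monom \<beta> x) \<ge> 0"
  unfolding sum_cube_eval_monom
  by (rule prod_nonneg) (simp add: minus_one_power_iff)

lemma one_in_cube [simp]: "(1 :: real ^ 'n::finite) \<in> cube"
  by (simp add: cube_def)

lemma eval_monom_cube:
  assumes "x \<in> cube"
  shows "eval_monom \<alpha> x = 1 \<or> eval_monom \<alpha> x = -1"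
proof -
  have "\<bar>eval_monom \<alpha> x\<bar> = 1"
    unfolding eval_monom_def abs_prod
  proof (rule prod.neutral, intro ballI)
    fix i
    have "\<bar>x $ i\<bar> = 1"
      using assms by (auto simp: cube_def dest: spec[of _ i])
    then show "\<bar>x $ i ^ \<alpha> $ i\<bar> = 1" by (simp add: power_abs)
  qed
  then show ?thesis by linarith
qed

lemma eval_monom_even_cube:
  assumes "x \<in> cube" "even_exponent \<alpha>"
  shows "eval_monom \<alpha> x = 1"
  unfolding eval_monom_def
proof (rule prod.neutral, intro ballI)
  fix i
  have "x $ i = 1 \<or> x $ i = -1" "even (\<alpha> $ i)"
    using assms by (auto simp: cube_def even_exponent_def)
  then show "x $ i ^ \<alpha> $ i = 1" by auto
qed

lemma eval_monom_at_1 [simp]: "eval_monom \<alpha> 1 = 1"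
  by (simp add: eval_monom_def)

text \<open>Two characters cut out a subgroup of index at most 4. Each of its points contributes
  \<open>F 1\<close>, and all other points contribute at least 0.\<close>

lemma sum_cube_ge:
  fixes F :: "real ^ 'n::finite \<Rightarrow> real"
  assumes nonneg: "\<And>x. x \<in> cube \<Longrightarrow> F x \<ge> 0"
    and const: "\<And>x. x \<in> cube \<Longrightarrow> eval_monom \<beta> x = 1 \<Longrightarrow> x $ i = 1 \<Longrightarrow> F x = F 1"
  shows "2 ^ CARD('n) * F 1 \<le> 4 * (\<Sum>x\<in>cube. F x)"
proof -
  \<comment> \<open>Four times the indicator function of the subgroup \<open>x\<^sup>\<beta> = x\<^sub>i = 1\<close>, as a sum of characters.\<close>
  define D where "D x = (1 + eval_monom \<beta> x) * (1 + x $ i)" for x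
  have "D x = 1 + eval_monom \<beta> x + eval_monom (axis i 1) x + eval_monom (\<beta> + axis i 1) x" for x
    by (simp add: D_def eval_monom_add eval_monom_axis algebra_simps)
  \<comment> \<open>The constant 1 contributes \<open>2 ^ CARD('n)\<close>, and the other three sums
    are nonnegative. This avoids a case split on whether the characters are trivial or
    coincide.\<close>
  then have "(\<Sum>x\<in>cube. D x) \<ge> 2 ^ CARD('n)"
    using sum_cube_eval_monom_nonneg[of \<beta>] sum_cube_eval_monom_nonneg[of "axis i 1"]
      sum_cube_eval_monom_nonneg[of "\<beta> + axis i 1"]
    by (simp add: sum.distrib card_cube)
  then have "2 ^ CARD('n) * F 1 \<le> (\<Sum>x\<in>cube. D x) * F 1"
    by (intro mult_right_mono) (auto intro: nonneg)
  also have "\<dots> = (\<Sum>x\<in>cube. D x * F 1)"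
    by (rule sum_distrib_right)
  also have "\<dots> \<le> (\<Sum>x\<in>cube. 4 * F x)"
  proof (rule sum_mono)
    fix x :: "real ^ 'n" assume x: "x \<in> cube"
    then have "x $ i = 1 \<or> x $ i = -1" by (auto simp: cube_def)
    then show "D x * F 1 \<le> 4 * F x"
      using eval_monom_cube[OF x, of \<beta>] nonneg[OF x] const[OF x] by (auto simp: D_def)
  qed
  finally show ?thesis by (simp add: sum_distrib_left)
qed

section \<open>Circuit polynomials and multipliers on the cube\<close>

lemma nonneg_circuit_polynomial_cube:
  assumes "nonneg_circuit_polynomial q"
  obtains \<beta> where "\<And>x. x \<in> cube \<Longrightarrow> eval_mpoly q x \<ge> 0"
    and "\<And>x. x \<in> cube \<Longrightarrow> eval_monom \<beta> x = 1 \<Longrightarrow> eval_mpoly q x = eval_mpoly q 1"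
  using assms unfolding nonneg_circuit_polynomial_def
proof (elim disjE conjE)
  assume nonneg: "\<forall>x. eval_mpoly q x \<ge> 0" and "circuit_polynomial q"
  then obtain r :: nat and \<alpha> f \<beta> b where even: "\<forall>j\<le>r. even_exponent (\<alpha> j)"
    and q: "q = (\<Sum>j\<le>r. Poly_Mapping.single (\<alpha> j) (f j)) + Poly_Mapping.single \<beta> b"
    unfolding circuit_polynomial_def by blast
  \<comment> \<open>The vertices of the simplex are even, so their monomials equal 1 on the cube and
    only the inner term can vary.\<close>
  have "eval_mpoly q x = (\<Sum>j\<le>r. f j) + b * eval_monom \<beta> x" if "x \<in> cube" for x
    using even that by (simp add: q eval_monom_even_cube)
  then show thesis using nonneg by (intro that[of \<beta>]) (blast, simp)
next
  assume "monomial_square q"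
  then obtain c \<alpha> where "c > 0" "even_exponent \<alpha>" "q = Poly_Mapping.single \<alpha> c"
    unfolding monomial_square_def by blast
  \<comment> \<open>A monomial square is constant on the cube, so the trivial character
    serves.\<close>
  then show thesis by (intro that[of 0]) (auto simp: eval_monom_even_cube)
qed

lemma hypercube_multipliers_cube:
  assumes "h \<in> hypercube_multipliers"
  obtains i where "\<And>x. x \<in> cube \<Longrightarrow> eval_mpoly h x \<ge> 0"
    and "\<And>x. x \<in> cube \<Longrightarrow> x $ i = 1 \<Longrightarrow> eval_mpoly h x = eval_mpoly h 1"
proof -
  have square: "(x $ i)\<^sup>2 = 1" if "x \<in> cube" for x :: "real ^ 'a" and i
  proof -
    have "x $ i = 1 \<or> x $ i = -1" using that by (simp add: cube_def)
    then show ?thesis by auto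
  qed
  consider "h = 1" | i where "h = (Var i)\<^sup>2 - 1 \<or> h = - ((Var i)\<^sup>2 - 1)"
    | i c where "c \<ge> 0" "h = 1 + Const c + Var i \<or> h = 1 + Const c - Var i"
    using assms unfolding hypercube_multipliers_def by blast
  then show thesis
  proof cases
    case 1
    then show ?thesis by (intro that) auto
  next
    case (2 i)
    \<comment> \<open>These multipliers vanish on the cube, so any coordinate serves as
      witness.\<close>
    then have "eval_mpoly h x = 0" if "x \<in> cube" for x
      using square[OF that, of i] by auto
    then show ?thesis by (intro that) auto
  next
    case (3 i c)
    have "eval_mpoly h x \<ge> 0" if "x \<in> cube" for x
    proof -
      have "x $ i = 1 \<or> x $ i = -1" using that by (simp add: cube_def)
      then show ?thesis using 3 by auto
    qed
    then show ?thesis using 3 by (intro that[of i]) auto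
  qed
qed

text \<open>Both sides are linear in \<open>p\<close>, so it suffices to treat a single product of a
  scaled nonnegative circuit polynomial and a multiplier, where \<open>sum_cube_ge\<close>
  applies.\<close>

lemma sum_cube_S_ge:
  fixes p :: "'n::finite mpoly"
  assumes "p \<in> S d"
  shows "2 ^ CARD('n) * eval_mpoly p 1 \<le> 4 * (\<Sum>x\<in>cube. eval_mpoly p x)"
proof -
  let ?L = "\<lambda>p :: 'n mpoly. 4 * (\<Sum>x\<in>cube. eval_mpoly p x) - 2 ^ CARD('n) * eval_mpoly p 1"
  \<comment> \<open>Additivity is applied twice: to the sum of products \<open>s j * h j\<close>,
    and to the circuit decomposition of each \<open>s j\<close>.\<close>
  have L_sum: "?L (\<Sum>j\<in>A. g j) = (\<Sum>j\<in>A. ?L (g j))" for A :: "nat set" and g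
    by (simp add: sum_subtractf sum_distrib_left sum.swap[of _ A])
  obtain m s h where sh: "\<forall>j<m. s j \<in> SONC d \<and> h j \<in> hypercube_multipliers"
    and p: "p = (\<Sum>j<(m::nat). s j * h j)"
    using assms unfolding S_def by blast
  have "?L (s j * h j) \<ge> 0" if "j < m" for j
  proof -
    have sj: "s j \<in> SONC d" and hj: "h j \<in> hypercube_multipliers"
      using sh that by auto
    from sj obtain k :: nat and \<mu> q where \<mu>: "\<forall>i\<in>{1..k}. \<mu> i \<ge> 0 \<and> nonneg_circuit_polynomial (q i)"
      and s: "s j = (\<Sum>i\<in>{1..k}. Const (\<mu> i) * q i)"
      unfolding SONC_def by blast
    from hj obtain i where i: "\<And>x. x \<in> cube \<Longrightarrow> eval_mpoly (h j) x \<ge> 0"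
      "\<And>x. x \<in> cube \<Longrightarrow> x $ i = 1 \<Longrightarrow> eval_mpoly (h j) x = eval_mpoly (h j) 1"
      by (rule hypercube_multipliers_cube) blast
    have "?L (Const (\<mu> l) * q l * h j) \<ge> 0" if l: "l \<in> {1..k}" for l
    proof -
      have "nonneg_circuit_polynomial (q l)" using \<mu> l by blast
      then obtain \<beta> where \<beta>: "\<And>x. x \<in> cube \<Longrightarrow> eval_mpoly (q l) x \<ge> 0"
        "\<And>x. x \<in> cube \<Longrightarrow> eval_monom \<beta> x = 1 \<Longrightarrow> eval_mpoly (q l) x = eval_mpoly (q l) 1"
        by (rule nonneg_circuit_polynomial_cube) blast
      have "2 ^ CARD('n) * eval_mpoly (Const (\<mu> l) * q l * h j) 1 \<le>
          4 * (\<Sum>x\<in>cube. eval_mpoly (Const (\<mu> l) * q l * h j) x)"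
      proof (rule sum_cube_ge)
        fix x :: "real ^ 'n" assume x: "x \<in> cube"
        show "eval_mpoly (Const (\<mu> l) * q l * h j) x \<ge> 0"
          using \<mu> l i(1)[OF x] \<beta>(1)[OF x] by simp
        assume "eval_monom \<beta> x = 1" "x $ i = 1"
        then show "eval_mpoly (Const (\<mu> l) * q l * h j) x = eval_mpoly (Const (\<mu> l) * q l * h j) 1"
          using i(2)[OF x] \<beta>(2)[OF x] by simp
      qed
      then show ?thesis by simp
    qed
    then have "(\<Sum>l\<in>{1..k}. ?L (Const (\<mu> l) * q l * h j)) \<ge> 0"
      by (rule sum_nonneg)
    then show ?thesis
      unfolding s sum_distrib_right L_sum .
  qed
  then have "(\<Sum>j<m. ?L (s j * h j)) \<ge> 0"
    by (intro sum_nonneg) (simp only: lessThan_iff)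
  then have "?L p \<ge> 0"
    unfolding p L_sum .
  then show ?thesis by simp
qed

section \<open>The values of \<open>f_poly\<close> and the contradiction\<close>

lemma eval_f_poly_cube:
  assumes "x \<in> cube"
  shows "eval_mpoly (f_poly a) x = (if x = 1 then real a else 1)"
proof (cases "x = 1")
  case False
  then obtain i where "x $ i \<noteq> 1" by (auto simp: vec_eq_iff)
  then have "x $ i = -1" using assms by (auto simp: cube_def)
  then have "(\<Prod>j\<in>UNIV. 1 / 2 * (x $ j + 1)) = 0"
    by (intro prod_zero) (auto intro: exI[of _ i])
  then show ?thesis using False by (simp add: f_poly_def)
qed (simp add: f_poly_def)

theorem theorem5p1:
  fixes a :: nat
  assumes "CARD('n::finite) \<ge> 3"
    and "real a > (2 ^ CARD('n) - 1) / (2 ^ (CARD('n) - 2) - 1)"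
  shows "\<forall>d::nat. (f_poly a :: 'n mpoly) \<notin> S d"
proof (intro allI notI)
  fix d assume "(f_poly a :: 'n mpoly) \<in> S d"
  then have le: "2 ^ CARD('n) * eval_mpoly (f_poly a) (1 :: real ^ 'n) \<le>
      4 * (\<Sum>x\<in>(cube :: (real ^ 'n) set). eval_mpoly (f_poly a) x)"
    by (rule sum_cube_S_ge)
  have "(\<Sum>x\<in>(cube :: (real ^ 'n) set). eval_mpoly (f_poly a) x) =
      (\<Sum>x\<in>(cube :: (real ^ 'n) set). 1 + (if x = 1 then real a - 1 else 0))"
    by (rule sum.cong) (auto simp: eval_f_poly_cube)
  also have "\<dots> = 2 ^ CARD('n) + (real a - 1)"
    by (simp add: sum.distrib card_cube)
  finally have sum: "(\<Sum>x\<in>(cube :: (real ^ 'n) set). eval_mpoly (f_poly a) x) =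
    2 ^ CARD('n) + (real a - 1)" .
  \<comment> \<open>This turns the truncated subtraction \<open>CARD('n) - 2\<close> into
    \<open>k + 1\<close>, so the denominator is visibly positive and can be cleared.\<close>
  obtain k where k: "CARD('n) = k + 3"
    using assms(1) by (metis add.commute le_Suc_ex)
  have pos: "(2::real) ^ (k + 1) > 1"
    by (rule one_less_power) auto
  have "8 * 2 ^ k - 1 < real a * (2 * 2 ^ k - 1)"
    using assms(2) pos by (simp add: k power_add field_simps)
  \<comment> \<open>Dividing by 4 and collecting \<open>real a\<close> gives the reverse of the
    preceding strict inequality.\<close>
  moreover have "2 ^ CARD('n) * real a \<le> 4 * (2 ^ CARD('n) + (real a - 1))"
    using le unfolding sum by (simp add: eval_f_poly_cube)
  ultimately show False
    by (simp add: k power_add algebra_simps)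
qed

end
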